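(* Let $G$ be a graph with $n$ vertices. Then for every integer $k\geq 1$ with $n\geq k+1$, $$\chi(F_k(G))\geq \left(\frac{1}{2}+\frac{2}{n}\right)\chi(G)-1.$$
   Context: Graphs are finite, simple and undirected. For a graph $G$ and an integer $k\geq 1$, the $k$-token graph $F_k(G)$ is the graph whose vertices are the $k$-element subsets of $V(G)$, where two vertices $A,B$ are adjacent whenever their symmetric difference $A\triangle B$ is a pair $\{a,b\}$ with $a\in A$, $b\in B$ and $ab\in E(G)$. $\chi$ denotes the chromatic number. *)

theory Defs
  imports Complex_Main "Graph_Theory.Pair_Digraph"
begin

text \<open>
  A finite simple undirected graph is a \<^locale>\<open>pair_graph\<close>: a finite vertex set with a symmetric,
  irreflexive set of arcs, where the edge \<open>uv\<close> is represented by the two arcs \<open>(u, v)\<close> and \<open>(v, u)\<close>.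
\<close>

definition proper_coloring :: "'a pair_pre_digraph \<Rightarrow> ('a \<Rightarrow> nat) \<Rightarrow> nat \<Rightarrow> bool" where
  "proper_coloring G f c \<longleftrightarrow>
     f ` pverts G \<subseteq> {..<c} \<and> (\<forall>(u, v) \<in> parcs G. f u \<noteq> f v)"

definition chromatic_number :: "'a pair_pre_digraph \<Rightarrow> nat" where
  "chromatic_number G = (LEAST c. \<exists>f. proper_coloring G f c)"

definition token_graph :: "nat \<Rightarrow> 'a pair_pre_digraph \<Rightarrow> 'a set pair_pre_digraph" where
  "token_graph k G =
     \<lparr> pverts = {A. A \<subseteq> pverts G \<and> card A = k},
       parcs = {(A, B). A \<subseteq> pverts G \<and> card A = k \<and> B \<subseteq> pverts G \<and> card B = k \<and>
                 (\<exists>a \<in> A. \<exists>b \<in> B. sym_diff A B = {a, b} \<and> (a, b) \<in> parcs G)} \<rparr>"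

lemma pair_graph_token_graph:
  assumes "pair_graph G"
  shows "pair_graph (token_graph k G)"
proof -
  interpret pair_graph G by fact
  have fin: "finite (pverts (token_graph k G))"
    by (rule finite_subset[of _ "Pow (pverts G)"])
       (auto simp: token_graph_def pair_finite_verts)
  have sub: "parcs (token_graph k G) \<subseteq> pverts (token_graph k G) \<times> pverts (token_graph k G)"
    by (auto simp: token_graph_def)
  have sym: "(B, A) \<in> parcs (token_graph k G)" if "(A, B) \<in> parcs (token_graph k G)" for A B
  proof -
    from that have AB: "A \<subseteq> pverts G" "card A = k" "B \<subseteq> pverts G" "card B = k"
      and "\<exists>a \<in> A. \<exists>b \<in> B. sym_diff A B = {a, b} \<and> (a, b) \<in> parcs G"
      by (simp_all add: token_graph_def)
    then obtain a b where ab: "a \<in> A" "b \<in> B" "sym_diff A B = {a, b}" "(a, b) \<in> parcs G"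
      by blast
    have "sym_diff B A = sym_diff A B" by (rule Un_commute)
    then have "sym_diff B A = {b, a}" using ab(3) by (simp only: insert_commute)
    moreover have "(b, a) \<in> parcs G"
      using ab(4) pair_sym_arcs symD[of "parcs G" a b] by (simp add: symmetric_def)
    ultimately have "\<exists>b \<in> B. \<exists>a \<in> A. sym_diff B A = {b, a} \<and> (b, a) \<in> parcs G"
      using ab(1,2) by (intro bexI conjI)
    then show ?thesis using AB by (simp add: token_graph_def)
  qed
  have irrefl: "A \<noteq> B" if "(A, B) \<in> parcs (token_graph k G)" for A B
  proof
    assume "A = B"
    then have "sym_diff A B = {}" by simp
    with that show False by (auto simp only: token_graph_def pair_pre_digraph.simps mem_Collect_eq
        prod.case)
  qed
  show ?thesis
  proof
    show "finite (pverts (token_graph k G))" by (fact fin)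
    show "finite (parcs (token_graph k G))"
      using finite_subset[OF sub] fin by simp
    show "symmetric (token_graph k G)"
      unfolding symmetric_def with_proj_simps by (rule symI) (rule sym)
    show "fst e \<noteq> snd e" if "e \<in> parcs (token_graph k G)" for e
      using irrefl[of "fst e" "snd e"] that by simp
    show "fst e \<in> pverts (token_graph k G)" "snd e \<in> pverts (token_graph k G)"
      if "e \<in> parcs (token_graph k G)" for e
      using subsetD[OF sub that] by (simp_all add: mem_Times_iff)
  qed
qed

lemma proper_coloring_chromatic_number:
  assumes "pair_graph G"
  shows "\<exists>f. proper_coloring G f (chromatic_number G)"
proof -
  interpret pair_graph G by fact
  obtain f :: "'a \<Rightarrow> nat" where f: "inj_on f (pverts G)" "f ` pverts G = {..<card (pverts G)}"
    using ex_bij_betw_finite_nat[OF pair_finite_verts]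
    by (auto simp: bij_betw_def lessThan_atLeast0)
  have "f u \<noteq> f v" if "(u, v) \<in> parcs G" for u v
    using that inj_onD[OF f(1), of u v] in_arcsD1[of u v] in_arcsD2[of u v] pair_no_loops[of "(u, v)"]
    by auto
  then have "\<exists>f. proper_coloring G f (card (pverts G))"
    using f(2) by (intro exI[of _ f]) (auto simp: proper_coloring_def)
  then show ?thesis
    unfolding chromatic_number_def by (rule LeastI[where P = "\<lambda>c. \<exists>f. proper_coloring G f c"])
qed

end

theory Submission
  imports Defs
begin

text \<open>
  Fixing all tokens but one on a set \<open>S\<close> of \<open>k - 1\<close> vertices embeds \<open>G - S\<close> into \<open>F\<^sub>k(G)\<close>;
  taking complements, a set \<open>S\<close> of \<open>n - k - 1\<close> vertices works as well, so \<open>S\<close> can be chosen of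
  size at most \<open>n / 2 - 1\<close>. If \<open>S\<close> lies in the union of \<open>j\<close> colour classes of an
  optimal colouring of \<open>G\<close>, then giving these classes \<open>j\<close> new colours shows
  \<open>\<chi>(G) \<le> \<chi>(F\<^sub>k(G)) + j\<close>. The \<open>j\<close> largest classes contain at least \<open>n / 2 - 3 / 2\<close> vertices
  already for some \<open>j \<le> \<chi>(G) / 2 + 1 - 2 \<chi>(G) / n\<close>, and the claim follows.
\<close>

text \<open>Since \<open>r\<close> renumbers the values of \<open>h\<close>, colours may come from
  any type. This admits the disjoint sum of two palettes below, and it forces an optimal colouring
  to use every colour.\<close>

lemma chromatic_number_le_card_image:
  assumes "pair_graph G" and "\<And>u v. (u, v) \<in> parcs G \<Longrightarrow> h u \<noteq> h v"
  shows "chromatic_number G \<le> card (h ` pverts G)"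
proof -
  interpret pair_graph G by fact
  obtain r :: "'b \<Rightarrow> nat" where r: "bij_betw r (h ` pverts G) {..<card (h ` pverts G)}"
    using ex_bij_betw_finite_nat[of "h ` pverts G"] pair_finite_verts
    by (auto simp: lessThan_atLeast0)
  have "r (h u) \<noteq> r (h v)" if "(u, v) \<in> parcs G" for u v
    using inj_onD[OF bij_betw_imp_inj_on[OF r], of "h u" "h v"] assms(2)[OF that]
      in_arcsD1[OF that] in_arcsD2[OF that] by auto
  then have "proper_coloring G (r \<circ> h) (card (h ` pverts G))"
    using bij_betw_imp_surj_on[OF r] by (auto simp: proper_coloring_def)
  then show ?thesis
    unfolding chromatic_number_def by (intro Least_le exI)
qed

lemma token_graph_arc_insert:
  assumes "pair_graph G" "(u, v) \<in> parcs G" "S \<subseteq> pverts G" "u \<notin> S" "v \<notin> S" "Suc (card S) = k"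
  shows "(insert u S, insert v S) \<in> parcs (token_graph k G)"
proof -
  interpret pair_graph G by fact
  have "finite S" using assms(3) pair_finite_verts by (rule finite_subset)
  moreover have "u \<in> pverts G" "v \<in> pverts G" "u \<noteq> v"
    using assms(2) in_arcsD1 in_arcsD2 pair_no_loops by force+
  moreover from this have "sym_diff (insert u S) (insert v S) = {u, v}"
    using assms(4,5) by auto
  ultimately show ?thesis using assms by (auto simp: token_graph_def)
qed

text \<open>With \<open>W\<close> the vertices outside \<open>S\<close> and the edge,
  complementation turns \<open>insert v S\<close> into \<open>insert u W\<close>, so the previous
  lemma applies to \<open>W\<close>.\<close>

lemma token_graph_arc_complement:
  assumes "pair_graph G" "(u, v) \<in> parcs G" "S \<subseteq> pverts G" "u \<notin> S" "v \<notin> S"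
    and "card (pverts G) = Suc (card S) + k"
  shows "(pverts G - insert v S, pverts G - insert u S) \<in> parcs (token_graph k G)"
proof -
  interpret pair_graph G by fact
  define W where "W = pverts G - insert u (insert v S)"
  have uv: "u \<in> pverts G" "v \<in> pverts G" "u \<noteq> v"
    using assms(2) in_arcsD1 in_arcsD2 pair_no_loops by force+
  have finS: "finite S" using assms(3) pair_finite_verts by (rule finite_subset)
  then have "card (insert u (insert v S)) = Suc (Suc (card S))" using assms uv by simp
  moreover have "card (insert u (insert v S)) \<le> card (pverts G)"
    using assms(3) uv pair_finite_verts by (intro card_mono) auto
  ultimately have "Suc (card W) = k"
    using assms(3,6) uv finS by (simp add: W_def card_Diff_subset)
  then have "(insert u W, insert v W) \<in> parcs (token_graph k G)"
    using assms by (intro token_graph_arc_insert) (auto simp: W_def)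
  moreover have "insert u W = pverts G - insert v S" "insert v W = pverts G - insert u S"
    using assms uv by (auto simp: W_def)
  ultimately show ?thesis by simp
qed

lemma chromatic_number_le_token_graph_add:
  assumes G: "pair_graph G" and S: "S \<subseteq> pverts G"
    and cS: "Suc (card S) = k \<or> card (pverts G) = Suc (card S) + k"
    and g: "\<And>u v. (u, v) \<in> parcs G \<Longrightarrow> g u \<noteq> g v" and J: "finite J" "g ` S \<subseteq> J"
  shows "chromatic_number G \<le> chromatic_number (token_graph k G) + card J"
proof -
  interpret pair_graph G by fact
  let ?d = "chromatic_number (token_graph k G)"
  obtain f where f: "proper_coloring (token_graph k G) f ?d"
    using proper_coloring_chromatic_number[OF pair_graph_token_graph[OF G]] by blast
  define e where "e v = (if Suc (card S) = k then insert v S else pverts G - insert v S)" for v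
  have arc: "(e u, e v) \<in> parcs (token_graph k G) \<or> (e v, e u) \<in> parcs (token_graph k G)"
    if "(u, v) \<in> parcs G" "u \<notin> S" "v \<notin> S" for u v
    using token_graph_arc_insert[OF G that(1) S that(2,3)]
      token_graph_arc_complement[OF G that(1) S that(2,3)] cS by (auto simp: e_def)
  have vert: "e v \<in> pverts (token_graph k G)" if "v \<in> pverts G" "v \<notin> S" for v
    using that S cS finite_subset[OF S] pair_finite_verts
    by (auto simp: e_def token_graph_def card_Diff_subset)
  define h where "h v = (if g v \<in> J then Inr (g v) else Inl (f (e v)))" for v
  have "h u \<noteq> h v" if uv: "(u, v) \<in> parcs G" for u v
  proof
    assume eq: "h u = h v"
    with g[OF uv] have "g u \<notin> J" "g v \<notin> J" "f (e u) = f (e v)"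
      by (auto simp: h_def split: if_splits)
    with J(2) arc[OF uv] f show False by (fastforce simp: proper_coloring_def)
  qed
  then have le: "chromatic_number G \<le> card (h ` pverts G)"
    by (intro chromatic_number_le_card_image G)
  have "f (e v) < ?d" if "v \<in> pverts G" "g v \<notin> J" for v
    using vert[of v] that J(2) f by (auto simp: proper_coloring_def)
  then have "h ` pverts G \<subseteq> {..<?d} <+> J"
    by (auto simp: h_def)
  then have "card (h ` pverts G) \<le> card ({..<?d} <+> J)"
    using J(1) by (intro card_mono) auto
  also have "\<dots> = ?d + card J" using J(1) by (simp add: card_Plus)
  finally show ?thesis using le by linarith
qed

text \<open>Greedy choice: each step adds an element of maximal \<open>s\<close> among the rest, and
  its value becomes the new threshold.\<close>

lemma ex_largest_subset_threshold:
  fixes s :: "'b \<Rightarrow> nat"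
  assumes "finite A" "\<And>x. x \<in> A \<Longrightarrow> 1 \<le> s x" "j \<le> card A"
  shows "\<exists>J \<theta>. J \<subseteq> A \<and> card J = j \<and> 1 \<le> \<theta> \<and> (\<forall>x\<in>J. \<theta> \<le> s x) \<and> (\<forall>x\<in>A - J. s x \<le> \<theta>)"
  using assms(3)
proof (induction j)
  case 0
  \<comment> \<open>With nothing chosen, any positive upper bound of \<open>s\<close> is a
    threshold.\<close>
  have "s x \<le> Suc (sum s A)" if "x \<in> A" for x
    using member_le_sum[OF that, of s] assms(1) by simp
  then show ?case by (intro exI[of _ "{}"] exI[of _ "Suc (sum s A)"]) auto
next
  case (Suc j)
  then obtain J \<theta> where J: "J \<subseteq> A" "card J = j" "\<forall>x\<in>J. \<theta> \<le> s x" "\<forall>x\<in>A - J. s x \<le> \<theta>"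
    by auto
  have finJ: "finite J" using J(1) assms(1) by (rule finite_subset)
  have "A - J \<noteq> {}" using J(1,2) Suc.prems by auto
  then obtain x where x: "x \<in> A - J" "\<And>y. y \<in> A - J \<Longrightarrow> s y \<le> s x"
    using Max_in[of "s ` (A - J)"] Max_ge[of "s ` (A - J)"] assms(1)
    by (metis (no_types, lifting) finite_Diff finite_imageI image_iff image_is_empty)
  have "\<forall>y\<in>insert x J. s x \<le> s y" using J(3,4) x(1) by (auto intro: order_trans)
  then show ?case
    using J(1,2) x assms(2) finJ by (intro exI[of _ "insert x J"] exI[of _ "s x"]) auto
qed

text \<open>
  Here \<open>T\<close> stands for the number of vertices in the \<open>j\<close> largest of \<open>c\<close> nonempty classes, and
  \<open>\<theta>\<close> for a size that separates these classes from the others. The witness is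
  \<open>j = \<lfloor>c / 2 + 1 - 2 c / n\<rfloor>\<close>.
\<close>
lemma ex_number_of_classes:
  fixes c n :: nat
  assumes "2 \<le> n" "0 < c" "c \<le> n"
  shows "\<exists>j\<le>c. 2 * j * n + 4 * c \<le> c * n + 2 * n \<and>
    (\<forall>\<theta> T. 1 \<le> \<theta> \<longrightarrow> j * \<theta> \<le> T \<longrightarrow> n \<le> T + (c - j) * \<theta> \<longrightarrow> n \<le> 2 * T + 3)"
proof -
  obtain i where i: "c = 2 * i \<or> c = 2 * i + 1" by (metis oddE evenE)
  have ge2: "j * 2 \<le> T" if "\<theta> \<noteq> 1" "1 \<le> \<theta>" "j * \<theta> \<le> T" for j \<theta> T :: nat
    using that mult_le_mono2[of 2 \<theta> j] by linarith
  \<comment> \<open>The cut points 1/2, 1, 3/2 of \<open>2 * c / n\<close> determine the floor: it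
    is \<open>i + 1\<close> in \<open>many\<close>, \<open>i - 1\<close> in \<open>few_even\<close>
    and \<open>fewer_odd\<close>, and \<open>i\<close> otherwise.\<close>
  consider (half) "2 * c \<le> n" "c = 2 * i" | (many) "4 * c \<le> n" "c = 2 * i + 1"
    | (odd) "2 * c \<le> n" "n < 4 * c" "c = 2 * i + 1"
    | (few_even) "n < 2 * c" "c = 2 * i"
    | (few_odd) "n < 2 * c" "4 * c \<le> 3 * n" "c = 2 * i + 1"
    | (fewer_odd) "3 * n < 4 * c" "c = 2 * i + 1"
    using i by linarith
  then show ?thesis
  proof cases
    case half
    then show ?thesis by (intro exI[of _ i]) (auto simp: algebra_simps)
  next
    case many
    then have "n \<le> 2 * T + 3" if "(i + 1) * \<theta> \<le> T" "n \<le> T + (c - (i + 1)) * \<theta>" for \<theta> T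
      using that by (simp add: algebra_simps)
    with many show ?thesis by (intro exI[of _ "i + 1"]) (auto simp: algebra_simps)
  next
    case odd
    \<comment> \<open>Here \<open>n \<le> 2 * T + \<theta>\<close>, which settles \<theta> \<le> 3.
      For larger \<theta>, \<open>4 * i \<le> T\<close>, while \<open>n < 4 * c\<close> means
      \<open>n \<le> 8 * i + 3\<close>.\<close>
    have "n \<le> 2 * T + 3" if "i * \<theta> \<le> T" "n \<le> T + (c - i) * \<theta>" for \<theta> T
    proof (cases "\<theta> \<le> 3")
      case True
      then show ?thesis using that odd by (simp add: algebra_simps)
    next
      case False
      then have "i * 4 \<le> T" using that mult_le_mono2[of 4 \<theta> i] by linarith
      then show ?thesis using odd by simp
    qed
    with odd show ?thesis by (intro exI[of _ i]) (auto simp: algebra_simps)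
  next
    case few_even
    then obtain l where l: "i = l + 1" using assms(2) by (cases i) auto
    have "n \<le> 2 * T + 3" if "1 \<le> \<theta>" "l * \<theta> \<le> T" "n \<le> T + (c - l) * \<theta>" for \<theta> T
      using that ge2[of \<theta> l T] few_even l assms(3) by (cases "\<theta> = 1") auto
    with few_even l assms(3) show ?thesis by (intro exI[of _ l]) (auto simp: algebra_simps)
  next
    case few_odd
    have "n \<le> 2 * T + 3" if "1 \<le> \<theta>" "i * \<theta> \<le> T" "n \<le> T + (c - i) * \<theta>" for \<theta> T
      using that ge2[of \<theta> i T] few_odd assms(3) by (cases "\<theta> = 1") auto
    with few_odd show ?thesis by (intro exI[of _ i]) (auto simp: algebra_simps)
  next
    case fewer_odd
    then obtain l where l: "i = l + 1" using assms by (cases i) auto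
    \<comment> \<open>For \<theta> = 1 the excess \<open>c - 2 * l = 3\<close> is exactly the
      allowed slack. Otherwise \<open>2 * l \<le> T\<close> and
      \<open>3 * n \<le> 8 * l + 11\<close>, which suffices for \<open>l \<ge> 1\<close>; for
      \<open>l = 0\<close> rounding gives \<open>n \<le> 3\<close>.\<close>
    have "n \<le> 2 * T + 3" if "1 \<le> \<theta>" "l * \<theta> \<le> T" "n \<le> T + (c - l) * \<theta>" for \<theta> T
      using that ge2[of \<theta> l T] fewer_odd l assms(3) by (cases "\<theta> = 1"; cases "l = 0") auto
    with fewer_odd l assms(3) show ?thesis by (intro exI[of _ l]) (auto simp: algebra_simps)
  qed
qed

theorem theorem14:
  fixes G :: "'a pair_pre_digraph" and n k :: nat
  assumes "pair_graph G"
    and "card (pverts G) = n"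
    and "k \<ge> 1"
    and "n \<ge> k + 1"
  shows "real (chromatic_number (token_graph k G))
    \<ge> (1 / 2 + 2 / real n) * real (chromatic_number G) - 1"
proof -
  interpret pair_graph G by fact
  let ?c = "chromatic_number G"
  obtain g where g: "g ` pverts G \<subseteq> {..<?c}" "\<And>u v. (u, v) \<in> parcs G \<Longrightarrow> g u \<noteq> g v"
    using proper_coloring_chromatic_number[OF assms(1)] by (fastforce simp: proper_coloring_def)
  have le: "?c \<le> card (g ` pverts G)"
    using assms(1) g(2) by (rule chromatic_number_le_card_image)
  then have surj: "g ` pverts G = {..<?c}"
    using g(1) by (intro card_seteq) auto
  have c: "0 < ?c" "?c \<le> n"
    using surj assms le card_image_le[OF pair_finite_verts, of g] by (auto intro!: Nat.gr0I)
  then obtain j where j: "j \<le> ?c" "2 * j * n + 4 * ?c \<le> ?c * n + 2 * n"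
    "\<And>\<theta> T. 1 \<le> \<theta> \<Longrightarrow> j * \<theta> \<le> T \<Longrightarrow> n \<le> T + (?c - j) * \<theta> \<Longrightarrow> n \<le> 2 * T + 3"
    using ex_number_of_classes[of n ?c] assms(3,4) by auto
  define s where "s i = card {v \<in> pverts G. g v = i}" for i
  have "1 \<le> s i" if "i < ?c" for i
  proof -
    have "i \<in> g ` pverts G" using surj that by simp
    then show ?thesis using pair_finite_verts by (auto simp: s_def Suc_le_eq card_gt_0_iff)
  qed
  then obtain J \<theta> where J: "J \<subseteq> {..<?c}" "card J = j" "1 \<le> \<theta>"
    "\<forall>x\<in>J. \<theta> \<le> s x" "\<forall>x\<in>{..<?c} - J. s x \<le> \<theta>"
    using ex_largest_subset_threshold[of "{..<?c}" s j] j(1) by auto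
  have finJ: "finite J" using J(1) finite_subset by blast
  define U where "U = {v \<in> pverts G. g v \<in> J}"
  have card_eq: "card {v \<in> pverts G. g v \<in> I} = sum s I" if "finite I" for I
  proof -
    have "{v \<in> pverts G. g v \<in> I} = (\<Union>i\<in>I. {v \<in> pverts G. g v = i})" by auto
    also have "card \<dots> = sum s I"
      unfolding s_def using that pair_finite_verts by (intro card_UN_disjoint) auto
    finally show ?thesis .
  qed
  have "{v \<in> pverts G. g v \<in> {..<?c}} = pverts G" using surj by auto
  then have "n = sum s {..<?c}" using card_eq[of "{..<?c}"] assms(2) by simp
  also have "\<dots> = card U + sum s ({..<?c} - J)"
    using sum.subset_diff[OF J(1), of s] card_eq[OF finJ] by (simp add: U_def)
  also have "sum s ({..<?c} - J) \<le> (?c - j) * \<theta>"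
    using sum_bounded_above[of "{..<?c} - J" s \<theta>] J finJ by (simp add: card_Diff_subset)
  finally have "n \<le> card U + (?c - j) * \<theta>" by simp
  moreover have "j * \<theta> \<le> card U"
    using sum_bounded_below[of J \<theta> s] J card_eq[OF finJ] by (simp add: U_def)
  ultimately have "n \<le> 2 * card U + 3" using j(3) J(3) by blast
  \<comment> \<open>The minimum is at most \<open>n div 2\<close>, and by integrality
    \<open>n \<le> 2 * card U + 3\<close> yields \<open>n div 2 - 1 \<le> card U\<close>.\<close>
  then have "min k (n - k) - 1 \<le> card U" using assms(4) by linarith
  then obtain S where S: "S \<subseteq> U" "card S = min k (n - k) - 1"
    by (metis obtain_subset_with_card_n)
  have "?c \<le> chromatic_number (token_graph k G) + card J"
  proof (rule chromatic_number_le_token_graph_add[OF assms(1) _ _ g(2) finJ])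
    show "S \<subseteq> pverts G" "g ` S \<subseteq> J" using S(1) by (auto simp: U_def)
    show "Suc (card S) = k \<or> card (pverts G) = Suc (card S) + k"
      using S(2) assms(2-4) by linarith
  qed
  then have "real ?c - real j \<le> real (chromatic_number (token_graph k G))"
    using J(2) by linarith
  moreover have "(1 / 2 + 2 / real n) * real ?c - 1 \<le> real ?c - real j"
  proof -
    \<comment> \<open>Dividing by \<open>2 * n\<close> turns this into
      \<open>j \<le> c / 2 + 1 - 2 * c / n\<close>, with \<open>c\<close> the chromatic
      number.\<close>
    have "real (2 * j * n + 4 * ?c) \<le> real (?c * n + 2 * n)" using j(2) by (rule of_nat_mono)
    then show ?thesis using assms(4) by (simp add: field_simps)
  qed
  ultimately show ?thesis by linarith
qed

end
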